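(* Let $F(p)=\#\{u\in\{0,\ldots,p-1\}:\ q_p(u)=u\}$. Then $F(p)\le p^{11/12+o(1)}$ as $p\to\infty$ over primes $p$.
   Context: For a prime $p$ and an integer $u$ with $\gcd(u,p)=1$, the Fermat quotient $q_p(u)$ is the unique integer with $q_p(u)\equiv (u^{p-1}-1)/p \pmod p$ and $0\le q_p(u)\le p-1$; also $q_p(kp)=0$ for all $k\in\mathbb{Z}$. *)

theory Defs
  imports Complex_Main "HOL-Computational_Algebra.Primes"
begin

definition fermat_quotient :: "nat \<Rightarrow> int \<Rightarrow> int" where
  "fermat_quotient p u =
     (if int p dvd u then 0 else ((u ^ (p - 1) - 1) div int p) mod int p)"

definition F :: "nat \<Rightarrow> nat" where
  "F p = card {u \<in> {0..<p}. fermat_quotient p (int u) = int u}"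

end

theory Submission
  imports Defs "HOL-Number_Theory.Residues" "HOL-Computational_Algebra.Polynomial" "HOL-Library.FuncSet"
begin

text \<open>A fixed point \<open>u\<close> satisfies $u^p = u + p u^2$ modulo $p^2$. If \<open>v\<close> and \<open>u = v + d\<close> are
  fixed points, expanding $(v + d)^p$ shows that $x = v/d$ solves $g(x) = 2dx + \beta$ modulo $p$,
  where $g = ((1+X)^p - X^p - 1)/p$ and $\beta$ depends on \<open>d\<close> only. Since $g$ satisfies
  $X(1+X)g' = X - X^p$ modulo $p$, Stepanov's method in the form of Heath-Brown (used by him for
  Heilbronn's exponential sum) bounds the number of such \<open>x\<close> by $O(p^{2/3})$: some non-trivial
  combination of the polynomials $(1+X)^a g^b X^{pc}$ vanishes to high order at every solution.
  Summing over \<open>d\<close> gives $F(p)^2 = O(p^{5/3})$, so $F(p) = O(p^{5/6})$.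
  Fields with $p$ elements are avoided: all polynomials have integer coefficients, and linear algebra modulo
  $p$ is replaced by the pigeonhole principle.\<close>

section \<open>Zeros of integer polynomials modulo a prime\<close>

text \<open>The derivation w d/dX. Iterates with w = X(1+X) replace ordinary derivatives because
  X(1+X) \<open>g'\<close> is a polynomial of simple shape modulo p; where w is invertible they
  detect the same order of vanishing, up to order p.\<close>

definition wderiv :: "int poly \<Rightarrow> int poly \<Rightarrow> int poly" where
  "wderiv w P = w * pderiv P"

lemma wderiv_funpow_add: "(wderiv w ^^ n) (P + Q) = (wderiv w ^^ n) P + (wderiv w ^^ n) Q"
  by (induction n) (simp_all add: wderiv_def pderiv_add algebra_simps)

lemma wderiv_funpow_smult: "(wderiv w ^^ n) (smult k P) = smult k ((wderiv w ^^ n) P)"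
  by (induction n) (simp_all add: wderiv_def pderiv_smult)

lemma wderiv_funpow_diff: "(wderiv w ^^ n) (P - Q) = (wderiv w ^^ n) P - (wderiv w ^^ n) Q"
  by (induction n) (simp_all add: wderiv_def pderiv_diff right_diff_distrib)

lemma wderiv_funpow_0: "(wderiv w ^^ n) 0 = 0"
  by (induction n) (simp_all add: wderiv_def)

lemma wderiv_funpow_sum: "(wderiv w ^^ n) (\<Sum>i\<in>I. f i) = (\<Sum>i\<in>I. (wderiv w ^^ n) (f i))"
  by (induction I rule: infinite_finite_induct) (simp_all add: wderiv_funpow_0 wderiv_funpow_add)

text \<open>A term survives at x only if every derivation removes one factor X - x. One application
  to \<open>L^(k+1) Q\<close> gives \<open>L^k ((k+1) w Q + L w Q')\<close> with
  \<open>L = X - x\<close>, and the second summand in the bracket still vanishes at x.\<close>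

lemma poly_wderiv_funpow_linear_power:
  "poly ((wderiv w ^^ k) ([:-x, 1:] ^ k * Q)) x = fact k * poly w x ^ k * poly Q x"
proof (induction k arbitrary: Q)
  case (Suc k)
  let ?L = "[:-x, 1:] :: int poly"
  have "wderiv w (?L ^ Suc k * Q) = ?L ^ k * (smult (int (Suc k)) (w * Q) + ?L * w * pderiv Q)"
    unfolding wderiv_def pderiv_mult pderiv_power_Suc
    by (simp add: pderiv_pCons algebra_simps smult_add_left)
  hence "(wderiv w ^^ Suc k) (?L ^ Suc k * Q) =
           (wderiv w ^^ k) (?L ^ k * (smult (int (Suc k)) (w * Q) + ?L * w * pderiv Q))"
    by (simp add: funpow_swap1 del: power_Suc)
  thus ?case
    using Suc.IH[of "smult (int (Suc k)) (w * Q) + ?L * w * pderiv Q"]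
    by (simp add: algebra_simps)
qed simp

text \<open>Factors X - x are split off one at a time. With k of them removed, the k-th iterate at x
  is \<open>k! w(x)^k M(x) Q(x)\<close> modulo p; since k < D \<le> p all factors except
  \<open>Q(x)\<close> are invertible, so \<open>Q(x)\<close> is 0 modulo p. \<open>M\<close>
  collects the factors of the zeros already treated.\<close>

lemma factor_linear_power_mod_prime:
  fixes p :: nat
  assumes p: "prime p" and "D \<le> p"
    and M: "\<not> int p dvd poly M x" and w: "\<not> int p dvd poly w x"
    and van: "\<And>n. n < D \<Longrightarrow> int p dvd poly ((wderiv w ^^ n) P) x"
    and P: "P = M * Q0 + smult (int p) R0"
  shows "k \<le> D \<Longrightarrow> \<exists>Q R. P = M * [:-x, 1:] ^ k * Q + smult (int p) R"
proof (induction k)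
  case 0
  thus ?case using P by (metis mult.right_neutral power_0)
next
  case (Suc k)
  let ?L = "[:-x, 1:] :: int poly"
  have pi: "prime (int p)" using p by simp
  obtain Q R where QR: "P = M * ?L ^ k * Q + smult (int p) R"
    using Suc by auto
  have "P = ?L ^ k * (M * Q) + smult (int p) R"
    using QR by (simp add: mult_ac)
  hence "poly ((wderiv w ^^ k) P) x =
     fact k * poly w x ^ k * (poly M x * poly Q x) + int p * poly ((wderiv w ^^ k) R) x"
    by (simp add: wderiv_funpow_add wderiv_funpow_smult poly_wderiv_funpow_linear_power)
  hence "int p dvd fact k * poly w x ^ k * (poly M x * poly Q x)"
    using van[of k] Suc.prems by (metis Suc_le_lessD dvd_add_left_iff dvd_triv_left)
  moreover have "\<not> int p dvd fact k"
    using p Suc.prems \<open>D \<le> p\<close> prime_dvd_fact_iff[OF p, of k]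
    by (metis Suc_le_lessD int_dvd_int_iff leD of_nat_fact order.strict_trans2)
  moreover have "\<not> int p dvd poly w x ^ k"
    using pi w prime_dvd_power by blast
  ultimately have "int p dvd poly Q x"
    using pi M by (simp add: prime_dvd_mult_iff)
  then obtain c where c: "poly Q x = int p * c" by (elim dvdE)
  have "Q = ?L * synthetic_div Q x + [:int p * c:]"
    using synthetic_div_correct'[of x Q] c by simp
  hence "P = M * ?L ^ k * (?L * synthetic_div Q x + [:int p * c:]) + smult (int p) R"
    using QR by simp
  also have "[:int p * c:] = smult (int p) [:c:]" by simp
  also have "M * ?L ^ k * (?L * synthetic_div Q x + smult (int p) [:c:]) + smult (int p) R
      = M * ?L ^ Suc k * synthetic_div Q x + smult (int p) (M * ?L ^ k * [:c:] + R)"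
    unfolding power_Suc distrib_left mult_smult_right smult_add_right by (simp only: ac_simps)
  finally show ?case by blast
qed

lemma factor_prod_linear_powers_mod_prime:
  fixes p :: nat
  assumes p: "prime p" and D: "D \<le> p" and fin: "finite S"
    and inc: "\<And>x y. x \<in> S \<Longrightarrow> y \<in> S \<Longrightarrow> int p dvd x - y \<Longrightarrow> x = y"
    and w: "\<And>x. x \<in> S \<Longrightarrow> \<not> int p dvd poly w x"
    and van: "\<And>x n. x \<in> S \<Longrightarrow> n < D \<Longrightarrow> int p dvd poly ((wderiv w ^^ n) P) x"
  shows "\<exists>Q R. P = (\<Prod>x\<in>S. [:-x, 1:] ^ D) * Q + smult (int p) R"
  using fin inc w van
proof (induction S)
  case empty
  have "P = (\<Prod>x\<in>{}. [:-x, 1:] ^ D) * P + smult (int p) 0" by simp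
  thus ?case by blast
next
  case (insert x S)
  have pi: "prime (int p)" using p by simp
  obtain Q R where QR: "P = (\<Prod>x\<in>S. [:-x, 1:] ^ D) * Q + smult (int p) R"
    using insert.IH insert.prems by blast
  have "\<not> int p dvd x - y" if "y \<in> S" for y
    using insert.prems(1)[of x y] insert.hyps that by auto
  hence M: "\<not> int p dvd poly (\<Prod>x\<in>S. [:-x, 1:] ^ D) x"
    using pi insert.hyps(1) 
    by (auto simp: poly_prod prime_dvd_prod_iff dest: prime_dvd_power[OF pi])
  obtain Q' R' where "P = (\<Prod>x\<in>S. [:-x, 1:] ^ D) * [:-x, 1:] ^ D * Q' + smult (int p) R'"
    using factor_linear_power_mod_prime[OF p D M _ _ QR, of w D] insert.prems by blast
  moreover have "(\<Prod>x\<in>insert x S. [:-x, 1:] ^ D) = (\<Prod>x\<in>S. [:-x, 1:] ^ D) * [:-x, 1:] ^ D"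
    unfolding prod.insert[OF insert.hyps] by (rule mult.commute)
  ultimately show ?case by metis
qed

text \<open>Reducing \<open>R\<close> modulo the monic \<open>M\<close> leaves
  \<open>P - c R'\<close> a multiple of \<open>M\<close> of smaller degree than \<open>M\<close>,
  hence 0. As the leading coefficient is 1, pseudo-division is genuine division over the
  integers.\<close>

lemma const_dvd_if_degree_less_monic:
  fixes M :: "int poly"
  assumes M: "lead_coeff M = 1" and P: "P = M * Q + smult c R" and deg: "degree P < degree M"
  shows "[:c:] dvd P"
proof -
  obtain Q' R' where qr: "pseudo_divmod R M = (Q', R')" by fastforce
  have "M \<noteq> 0" using M by auto
  have R: "R = M * Q' + R'" and R': "R' = 0 \<or> degree R' < degree M"
    using pseudo_divmod[OF \<open>M \<noteq> 0\<close> qr] M by simp_all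
  have eq: "P - smult c R' = M * (Q + smult c Q')"
    unfolding P R by (simp add: algebra_simps smult_add_right)
  have "degree (smult c R') < degree M"
    using R' deg by (metis degree_smult_le le_less_trans not_gr_zero smult_0_right degree_0 not_less0)
  hence "degree (P - smult c R') < degree M" using deg by (rule degree_diff_less[rotated])
  hence "Q + smult c Q' = 0"
    unfolding eq using \<open>M \<noteq> 0\<close> by (metis add_lessD1 degree_mult_eq less_irrefl)
  hence "P = [:c:] * R'" using eq by simp
  thus ?thesis by (metis dvd_triv_left)
qed

text \<open>The product of all \<open>(X - x)^D\<close> is monic and divides \<open>P\<close> modulo
  p; if its degree exceeded that of \<open>P\<close>, then \<open>P\<close> would be 0 modulo
  p.\<close>

lemma card_zeros_mult_order_le_degree:
  fixes p :: nat
  assumes p: "prime p" and D: "D \<le> p" and fin: "finite S"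
    and inc: "\<And>x y. x \<in> S \<Longrightarrow> y \<in> S \<Longrightarrow> int p dvd x - y \<Longrightarrow> x = y"
    and w: "\<And>x. x \<in> S \<Longrightarrow> \<not> int p dvd poly w x"
    and van: "\<And>x n. x \<in> S \<Longrightarrow> n < D \<Longrightarrow> int p dvd poly ((wderiv w ^^ n) P) x"
    and P: "\<not> [:int p:] dvd P"
  shows "card S * D \<le> degree P"
proof (rule ccontr)
  let ?M = "\<Prod>x\<in>S. [:-x, 1:] ^ D :: int poly"
  assume "\<not> card S * D \<le> degree P"
  moreover have "degree ?M = card S * D"
    by (subst degree_prod_eq_sum_degree) (auto simp: degree_linear_power)
  ultimately have "degree P < degree ?M" by simp
  moreover have "lead_coeff ?M = 1"
    by (simp only: lead_coeff_prod lead_coeff_power) simp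
  ultimately show False
    using factor_prod_linear_powers_mod_prime[OF p D fin inc w van] P const_dvd_if_degree_less_monic
    by metis
qed

section \<open>Linear systems modulo p by the pigeonhole principle\<close>

text \<open>The \<open>p^|I|\<close> vectors with entries in [0, p) have at most
  \<open>p^|J|\<close> images, so two of them collide. Their difference solves the system, and it is
  non-zero modulo p because distinct entries in [0, p) are incongruent.\<close>

lemma homogeneous_system_mod:
  fixes c :: "'j \<Rightarrow> 'i \<Rightarrow> int" and p :: nat
  assumes p: "p > 1" and I: "finite I" and J: "finite J" and card: "card J < card I"
  shows "\<exists>l. (\<exists>i\<in>I. \<not> int p dvd l i) \<and> (\<forall>j\<in>J. int p dvd (\<Sum>i\<in>I. l i * c j i))"
proof -
  let ?V = "I \<rightarrow>\<^sub>E {0..<int p}" and ?W = "J \<rightarrow>\<^sub>E {0..<int p}"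
  let ?f = "\<lambda>l. \<lambda>j\<in>J. (\<Sum>i\<in>I. l i * c j i) mod int p"
  have "?f ` ?V \<subseteq> ?W" using p by auto
  moreover have "card ?W < card ?V"
    using I J p card by (simp add: card_funcsetE)
  moreover have "finite ?V" "finite ?W" using I J by (auto intro: finite_PiE)
  ultimately have "\<not> inj_on ?f ?V"
    using card_inj_on_le[of ?f ?V ?W] by linarith
  then obtain l l' where l: "l \<in> ?V" "l' \<in> ?V" "l \<noteq> l'" "?f l = ?f l'"
    by (auto simp: inj_on_def)
  obtain i where i: "i \<in> I" "l i \<noteq> l' i"
    using l PiE_ext by blast
  have "\<not> int p dvd l i - l' i"
  proof
    assume "int p dvd l i - l' i"
    hence "l i mod int p = l' i mod int p" by (simp add: mod_eq_dvd_iff)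
    moreover have "l i \<in> {0..<int p}" "l' i \<in> {0..<int p}" using l i by auto
    ultimately show False using i by simp
  qed
  moreover have "int p dvd (\<Sum>i\<in>I. (l i - l' i) * c j i)" if "j \<in> J" for j
  proof -
    have "?f l j = ?f l' j" using l(4) by (rule fun_cong)
    hence "int p dvd (\<Sum>i\<in>I. l i * c j i) - (\<Sum>i\<in>I. l' i * c j i)"
      using that by (simp add: mod_eq_dvd_iff)
    thus ?thesis by (simp add: sum_subtractf left_diff_distrib)
  qed
  ultimately show ?thesis using i by (intro exI[of _ "\<lambda>i. l i - l' i"]) blast
qed

section \<open>The polynomial $((1+X)^p - X^p - 1)/p$\<close>

lemma pderiv_sum: "pderiv (\<Sum>i\<in>I. f i) = (\<Sum>i\<in>I. pderiv (f i))"
  by (induction I rule: infinite_finite_induct) (simp_all add: pderiv_add)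

abbreviation (input) "X \<equiv> [:0, 1:] :: int poly"
abbreviation (input) "T \<equiv> [:1, 1:] :: int poly"

lemma coeff_X_power_mult: "coeff (X ^ n * P) k = (if k < n then 0 else coeff P (k - n))"
  using coeff_monom_mult[of 1 n P k] by (simp add: monom_altdef)

text \<open>For 0 < i < p the coefficient of \<open>X^i\<close> in \<open>g\<close> is congruent to
  \<open>(-1)^(i-1)/i\<close>, so modulo p this is the truncated series of log(1+X). The defining
  relation is multiplied by p to stay within integer polynomials.\<close>

locale mirimanoff =
  fixes p :: nat and g :: "int poly"
  assumes prime: "prime p"
    and g: "smult (int p) g = T ^ p - X ^ p - 1"
begin

lemma prime_int: "prime (int p)" using prime by simp

lemma p_gt_1: "p > 1" using prime prime_gt_1_nat by blast

lemma poly_g: "int p * poly g x = (1 + x) ^ p - x ^ p - 1"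
proof -
  have "int p * poly g x = poly (smult (int p) g) x" by simp
  also have "\<dots> = (1 + x) ^ p - x ^ p - 1" unfolding g by (simp add: poly_power)
  finally show ?thesis .
qed

lemma degree_g: "degree g \<le> p"
proof -
  have "degree (smult (int p) g) \<le> p"
    unfolding g
    by (intro degree_diff_le) (simp_all add: degree_linear_power)
  thus ?thesis using p_gt_1 by simp
qed

lemma pderiv_g: "pderiv g = T ^ (p - 1) - X ^ (p - 1)"
proof -
  have "smult (int p) (pderiv g) = pderiv (T ^ p - X ^ p - 1)"
    unfolding g[symmetric] by (simp add: pderiv_smult)
  also have "\<dots> = smult (int p) (T ^ (p - 1) - X ^ (p - 1))"
    by (simp add: pderiv_diff pderiv_power pderiv_pCons smult_diff_right pderiv_1)
  finally show ?thesis using p_gt_1 by (simp add: poly_eq_iff)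
qed

text \<open>The truncated form of (1+X) (log(1+X))' = 1. The summand \<open>p g\<close> makes the
  identity exact over the integers.\<close>

lemma T_pderiv_g: "T * pderiv g = 1 - X ^ (p - 1) + smult (int p) g"
proof -
  have p: "p = Suc (p - 1)" using p_gt_1 by simp
  have "T * pderiv g = T ^ Suc (p - 1) - (1 + X) * X ^ (p - 1)"
    unfolding pderiv_g by (simp add: algebra_simps)
  also have "\<dots> = T ^ p - X ^ Suc (p - 1) - X ^ (p - 1)"
    unfolding p[symmetric] by (subst (4) p) (simp only: power_Suc ring_distribs mult_1 diff_diff_eq add.commute)
  finally show ?thesis unfolding g using p by (simp add: algebra_simps)
qed

text \<open>The product rule. For \<open>b = 0\<close> the truncated exponent \<open>b - 1\<close>
  is harmless, its coefficient being 0.\<close>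

lemma T_pderiv_term:
  "T * pderiv (T ^ a * g ^ b) = smult (int a) (T ^ a * g ^ b)
     + smult (int b) (T ^ a * g ^ (b - 1)) * (1 - X ^ (p - 1) + smult (int p) g)"
proof -
  have a: "T * pderiv (T ^ a) = smult (int a) (T ^ a)"
    by (cases a) (simp_all add: pderiv_power_Suc pderiv_pCons del: power_Suc, simp add: mult_ac)
  have "T * pderiv (T ^ a * g ^ b) = (T * pderiv (T ^ a)) * g ^ b + T ^ a * (T * pderiv (g ^ b))"
    unfolding pderiv_mult by (simp only: ring_distribs ac_simps)
  also have "T * pderiv (g ^ b) = smult (int b) (g ^ (b - 1)) * (T * pderiv g)"
    unfolding pderiv_power by (simp only: mult_smult_right mult_smult_left ac_simps)
  finally show ?thesis unfolding a T_pderiv_g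
    by (simp only: mult_smult_right mult_smult_left ac_simps)
qed

section \<open>Independence of the products of powers of 1+X and \<open>g\<close> modulo p\<close>

definition logsum :: "nat \<Rightarrow> nat \<Rightarrow> (nat \<Rightarrow> nat \<Rightarrow> int) \<Rightarrow> int poly" where
  "logsum A B l = (\<Sum>a<A. \<Sum>b<B. smult (l a b) (T ^ a * g ^ b))"

text \<open>Below degree p - 1 the term \<open>X^(p-1)\<close> in \<open>T * pderiv g\<close> is
  invisible, so \<theta> - a0 maps a combination to another one: \<open>T^a g^b\<close> goes to
  \<open>(a - a0) T^a g^b + b T^a g^(b-1)\<close>.\<close>

lemma coeff_T_pderiv_logsum_cong:
  assumes l: "\<And>a. l a B = 0" and i: "i < p - 1"
  shows "[coeff (T * pderiv (logsum A B l)) i - a0 * coeff (logsum A B l) i =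
     coeff (logsum A B (\<lambda>a b. (int a - a0) * l a b + int (Suc b) * l a (Suc b))) i] (mod int p)"
proof -
  let ?e = "\<lambda>a b. coeff (T ^ a * g ^ b) i"
  have monomial: "[coeff (T * pderiv (T ^ a * g ^ b)) i = int a * ?e a b + int b * ?e a (b - 1)] (mod int p)" for a b
  proof -
    let ?Q = "smult (int b) (T ^ a * g ^ (b - 1))"
    have expand: "Q * (1 - Y + smult (int p) g) = Q - Y * Q + smult (int p) (Q * g)" for Q Y
      by (simp add: algebra_simps)
    have "coeff (T * pderiv (T ^ a * g ^ b)) i =
        int a * ?e a b + int b * ?e a (b - 1) + int p * coeff (?Q * g) i"
      unfolding T_pderiv_term expand using i by (simp only: coeff_add coeff_diff coeff_smult coeff_X_power_mult) simp
    thus ?thesis by (simp add: cong_iff_dvd_diff)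
  qed
  \<comment> \<open>Reindexing b to b + 1: the summand at 0 vanishes by the factor
    \<open>int b\<close>, the one at \<open>B\<close> by the assumption on \<open>l\<close>.\<close>
  have shift: "(\<Sum>b<B. l a b * (int b * ?e a (b - 1))) = (\<Sum>b<B. int (Suc b) * l a (Suc b) * ?e a b)" for a
  proof -
    let ?h = "\<lambda>b. l a b * (int b * ?e a (b - 1))"
    have "(\<Sum>b<B. ?h b) = (\<Sum>b<Suc B. ?h b)" using l by simp
    also have "\<dots> = ?h 0 + (\<Sum>b<B. ?h (Suc b))" by (rule sum.lessThan_Suc_shift)
    finally show ?thesis by (simp add: mult_ac)
  qed
  have "T * pderiv (logsum A B l) = (\<Sum>a<A. \<Sum>b<B. smult (l a b) (T * pderiv (T ^ a * g ^ b)))"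
    unfolding logsum_def pderiv_sum sum_distrib_left by (simp only: pderiv_smult mult_smult_right)
  hence "coeff (T * pderiv (logsum A B l)) i =
      (\<Sum>a<A. \<Sum>b<B. l a b * coeff (T * pderiv (T ^ a * g ^ b)) i)"
    by (simp only: coeff_sum coeff_smult)
  also have "[\<dots> = (\<Sum>a<A. \<Sum>b<B. l a b * (int a * ?e a b + int b * ?e a (b - 1)))] (mod int p)"
    by (intro cong_sum cong_scalar_left monomial)
  also have "(\<Sum>a<A. \<Sum>b<B. l a b * (int a * ?e a b + int b * ?e a (b - 1))) =
      (\<Sum>a<A. (\<Sum>b<B. l a b * int a * ?e a b) + (\<Sum>b<B. l a b * (int b * ?e a (b - 1))))"
    by (simp add: sum.distrib ring_distribs mult_ac)
  also have "\<dots> = (\<Sum>a<A. \<Sum>b<B. (l a b * int a + int (Suc b) * l a (Suc b)) * ?e a b)"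
    unfolding shift by (simp only: sum.distrib ring_distribs)
  finally have "[coeff (T * pderiv (logsum A B l)) i - a0 * coeff (logsum A B l) i =
     (\<Sum>a<A. \<Sum>b<B. (l a b * int a + int (Suc b) * l a (Suc b)) * ?e a b)
      - a0 * (\<Sum>a<A. \<Sum>b<B. l a b * ?e a b)] (mod int p)"
    by (intro cong_diff) (simp_all add: logsum_def coeff_sum)
  also have "(\<Sum>a<A. \<Sum>b<B. (l a b * int a + int (Suc b) * l a (Suc b)) * ?e a b)
      - a0 * (\<Sum>a<A. \<Sum>b<B. l a b * ?e a b) =
      coeff (logsum A B (\<lambda>a b. (int a - a0) * l a b + int (Suc b) * l a (Suc b))) i"
    unfolding logsum_def coeff_sum coeff_smult sum_distrib_left sum_subtractf[symmetric]
    by (intro sum.cong refl) (simp add: algebra_simps)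
  finally show ?thesis .
qed

text \<open>Coefficient i of (1+X) W' involves only coefficients i and i + 1 of W, so exactly one
  order of vanishing is given up.\<close>

lemma dvd_logsum_shift:
  assumes l: "\<And>a. l a B = 0" and k: "k \<le> p" and van: "\<forall>i<k. int p dvd coeff (logsum A B l) i"
  shows "\<forall>i<k-1. int p dvd
     coeff (logsum A B (\<lambda>a b. (int a - a0) * l a b + int (Suc b) * l a (Suc b))) i"
proof (intro allI impI)
  fix i assume i: "i < k - 1"
  have "coeff (T * pderiv (logsum A B l)) i
      = coeff (pderiv (logsum A B l)) i + (if i = 0 then 0 else coeff (pderiv (logsum A B l)) (i - 1))"
    by (simp add: coeff_pCons split: nat.split)
  moreover have "int p dvd coeff (pderiv (logsum A B l)) i"
    using van i by (auto simp: coeff_pderiv intro!: dvd_mult)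
  moreover have "int p dvd coeff (pderiv (logsum A B l)) (i - 1)" if "i \<noteq> 0"
    using van i that by (auto simp: coeff_pderiv intro!: dvd_mult)
  moreover have "int p dvd coeff (logsum A B l) i" using van i by auto
  ultimately have "int p dvd coeff (T * pderiv (logsum A B l)) i - a0 * coeff (logsum A B l) i"
    by auto
  moreover have "i < p - 1" using i k by simp
  note coeff_T_pderiv_logsum_cong[of l B, OF l this, of A a0]
  ultimately show "int p dvd coeff (logsum A B (\<lambda>a b. (int a - a0) * l a b + int (Suc b) * l a (Suc b))) i"
    using cong_dvd_iff by blast
qed

text \<open>Modulo $p$ and $X^p$ the polynomial \<open>g\<close> behaves like $\log(1+X)$. With \<open>\<theta> = (1+X) d/dX\<close>,
  the operator \<open>\<theta> - a\<close> therefore removes the last term of a combination of the $(1+X)^a g^b$,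
  ordered lexicographically, at the expense of one power of $X$.\<close>

lemma logsum_coeffs_dvd_aux:
  assumes "A \<le> p" "B \<le> p"
    and "\<And>a b. B \<le> b \<Longrightarrow> l a b = 0"
    and "\<And>a b. a < A \<Longrightarrow> b < B \<Longrightarrow> n \<le> a * B + b \<Longrightarrow> int p dvd l a b"
    and "n \<le> k" "k \<le> p" "\<forall>i<k. int p dvd coeff (logsum A B l) i"
    and "a < A" "b < B"
  shows "int p dvd l a b"
  using assms(3-)
\<comment> \<open>Only coefficients at lexicographic position a B + b < n may be non-zero modulo p,
  and at least n low coefficients of the combination vanish. Each use of \<theta> - a0 lowers both
  counts by one.\<close>
proof (induction n arbitrary: l k a b)
  case 0
  thus ?case by simp
next
  case (Suc n)
  note l = Suc.prems(1) and supp = Suc.prems(2) and ab = Suc.prems(6,7)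
  \<comment> \<open>The position of the last term that may survive; \<open>m\<close> below lists the
    coefficients after applying \<theta> - a0, which removes it.\<close>
  define a0 b0 where "a0 = n div B" and "b0 = n mod B"
  have n: "n = a0 * B + b0" and b0: "b0 < B"
    using ab by (simp_all add: a0_def b0_def)
  define m where "m = (\<lambda>a b. (int a - int a0) * l a b + int (Suc b) * l a (Suc b))"
  have suppm: "int p dvd m a b" if "a < A" "b < B" "n \<le> a * B + b" for a b
  proof -
    have 1: "int p dvd l a (Suc b)"
      using that supp[of a "Suc b"] l[of "Suc b" a] by (cases "Suc b < B") auto
    have 2: "int p dvd (int a - int a0) * l a b"
    proof (cases "n = a * B + b")
      case True
      hence "a = a0" using that by (simp add: a0_def)
      thus ?thesis by simp
    qed (use supp[of a b] that in auto)
    show ?thesis unfolding m_def using 1 2 by (intro dvd_add dvd_mult[of _ "l a (Suc b)"])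
  qed
  have m: "int p dvd m a b" if "a < A" "b < B" for a b
  proof (rule Suc.IH[of m "k - 1"])
    show "\<forall>i<k - 1. int p dvd coeff (logsum A B m) i"
      unfolding m_def using dvd_logsum_shift[of l B k A "int a0"] Suc.prems by auto
  qed (use suppm Suc.prems that l in \<open>auto simp: m_def\<close>)
  \<comment> \<open>The removed coefficient must be recovered. For b0 > 0 it is visible in
    \<open>m a0 (b0 - 1)\<close>, which is congruent to 0 and equals
    \<open>b0 * l a0 b0\<close>.\<close>
  have "int p dvd l a0 b0" if a0: "a0 < A"
  proof (cases b0)
    case (Suc b')
    have "int p dvd m a0 b'" using m a0 b0 Suc by simp
    hence "int p dvd int b0 * l a0 b0" using Suc by (simp add: m_def)
    moreover have "\<not> int p dvd int b0"
      unfolding int_dvd_int_iff using Suc b0 assms(2) by (auto dest!: dvd_imp_le)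
    ultimately show ?thesis using prime_int by (simp add: prime_dvd_mult_iff)
  next
    \<comment> \<open>Here \<theta> - a0 annihilates the last term \<open>T^a0\<close> without
      trace. All other coefficients are shown to vanish first; then the constant coefficient of the
      combination isolates \<open>l a0 0\<close>, as \<open>T^a0\<close> has constant coefficient
      1.\<close>
    case 0
    \<comment> \<open>Descending induction on the power of \<open>g\<close>, starting from
      \<open>l a B = 0\<close>: in \<open>m a b\<close> the factor a - a0 is invertible. For j \<ge>
      \<open>B\<close> the truncated \<open>B - j\<close> stays at 0.\<close>
    have lower: "int p dvd l a (B - j)" if "a < a0" for a j
    proof (induction j)
      case (Suc j)
      show ?case
      proof (cases "j < B")
        case True
        hence S: "Suc (B - Suc j) = B - j" by simp
        have "int p dvd m a (B - Suc j)" using m True that a0 by simp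
        hence "int p dvd (int a - int a0) * l a (B - Suc j)"
          unfolding m_def S using Suc.IH by (metis dvd_add_left_iff dvd_mult)
        moreover have "\<not> int p dvd int a - int a0"
        proof
          assume "int p dvd int a - int a0"
          hence "int p dvd int (a0 - a)" using that by (simp add: dvd_diff_commute of_nat_diff)
          hence "p dvd a0 - a" unfolding int_dvd_int_iff .
          thus False using that a0 assms(1) by (auto dest!: dvd_imp_le)
        qed
        ultimately show ?thesis using prime_int by (simp add: prime_dvd_mult_iff)
      qed (use Suc in simp)
    qed (simp add: l)
    have other: "int p dvd l a b" if "a < A" "b < B" "(a, b) \<noteq> (a0, 0)" for a b
    proof (cases "a < a0")
      case True
      thus ?thesis using lower[of a "B - b"] that by simp
    next
      case False
      have "Suc n \<le> a * B + b"
      proof (cases "a = a0")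
        case False
        hence "Suc a0 * B \<le> a * B" using \<open>\<not> a < a0\<close> by (intro mult_le_mono1) simp
        thus ?thesis using n 0 b0 by simp
      qed (use that n 0 in auto)
      thus ?thesis using supp that by blast
    qed
    have "int p dvd coeff (logsum A B l) 0" using Suc.prems by auto
    also have "coeff (logsum A B l) 0 = (\<Sum>z\<in>{..<A}\<times>{..<B}. l (fst z) (snd z) * coeff (T ^ fst z * g ^ snd z) 0)"
      unfolding logsum_def coeff_sum coeff_smult sum.cartesian_product by (simp add: case_prod_beta)
    also have "\<dots> = l a0 0 * coeff (T ^ a0 * g ^ 0) 0
       + (\<Sum>z\<in>{..<A}\<times>{..<B} - {(a0, 0)}. l (fst z) (snd z) * coeff (T ^ fst z * g ^ snd z) 0)"
      using a0 b0 by (subst sum.remove[of _ "(a0, 0)"]) auto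
    also have "coeff (T ^ a0 * g ^ 0) 0 = 1"
      by (simp add: coeff_0_power)
    finally have "int p dvd l a0 0 * 1 + 
       (\<Sum>z\<in>{..<A}\<times>{..<B} - {(a0, 0)}. l (fst z) (snd z) * coeff (T ^ fst z * g ^ snd z) 0)" .
    moreover have "int p dvd
       (\<Sum>z\<in>{..<A}\<times>{..<B} - {(a0, 0)}. l (fst z) (snd z) * coeff (T ^ fst z * g ^ snd z) 0)"
    proof (intro dvd_sum dvd_mult2)
      fix z assume "z \<in> {..<A} \<times> {..<B} - {(a0, 0)}"
      thus "int p dvd l (fst z) (snd z)" using other[of "fst z" "snd z"] by (cases z) auto
    qed
    ultimately show ?thesis using 0 by (simp add: dvd_add_left_iff)
  qed
  hence "int p dvd l a b" if "a < A" "b < B" "n \<le> a * B + b" for a b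
  proof (cases "n = a * B + b")
    case True
    hence "a = a0" "b = b0" using that by (simp_all add: a0_def b0_def)
    thus ?thesis using \<open>a0 < A \<Longrightarrow> int p dvd l a0 b0\<close> that by simp
  qed (use supp that in auto)
  thus ?case using Suc.IH[of l k a b] Suc.prems by auto
qed

lemma logsum_coeffs_dvd:
  assumes AB: "A \<le> p" "B \<le> p" "A * B \<le> p"
    and van: "\<forall>i<p. int p dvd coeff (logsum A B l) i"
    and ab: "a < A" "b < B"
  shows "int p dvd l a b"
proof -
  \<comment> \<open>Zero beyond the summation range, as the induction demands; it is started with n
    = \<open>A * B\<close> and k = p.\<close>
  define l' where "l' = (\<lambda>a b. if b < B then l a b else 0)"
  have "logsum A B l' = logsum A B l" unfolding logsum_def l'_def by simp
  moreover have "a * B + b < A * B" if "a < A" "b < B" for a b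
  proof -
    have "a * B + b < Suc a * B" using that by simp
    also have "\<dots> \<le> A * B" using that by (intro mult_le_mono1) simp
    finally show ?thesis .
  qed
  ultimately have "int p dvd l' a b"
    using van AB ab by (intro logsum_coeffs_dvd_aux[of A B l' "A * B" p a b]) (auto simp: l'_def dest: leD)
  thus ?thesis using ab by (simp add: l'_def)
qed

section \<open>The auxiliary polynomials of Stepanov's method\<close>

text \<open>The degree is of order p(b + c), but at a solution x the values \<open>g(x)\<close> and
  \<open>x^p\<close> may be replaced by \<alpha> x + \<beta> and x, so the values are those of a
  polynomial of degree at most a + b + c.\<close>

definition auxterm :: "nat \<Rightarrow> nat \<Rightarrow> nat \<Rightarrow> int poly" where
  "auxterm a b c = T ^ a * g ^ b * X ^ (p * c)"

lemma degree_auxterm: "degree (auxterm a b c) \<le> a + p * b + p * c"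
proof -
  have "degree (auxterm a b c) \<le> degree (T ^ a) + degree (g ^ b) + degree (X ^ (p * c))"
    unfolding auxterm_def by (meson add_mono degree_mult_le le_refl order_trans)
  moreover have "degree (g ^ b) \<le> p * b"
    using degree_power_le[of g b] degree_g by (meson le_trans mult_le_mono1)
  ultimately show ?thesis by (simp add: degree_linear_power)
qed

text \<open>The coefficients at \<open>p c, ..., p c + p - 1\<close> see no summand with a larger
  power \<open>X^(p c')\<close>, and those with c' < c vanish modulo p by induction. Hence the first
  p coefficients of the cofactor of \<open>X^(p c)\<close> vanish, and independence of the
  \<open>T^a g^b\<close> applies.\<close>

lemma auxsum_coeffs_dvd:
  assumes AB: "A \<le> p" "B \<le> p" "A * B \<le> p"
    and dvd: "[:int p:] dvd (\<Sum>c<C. \<Sum>a<A. \<Sum>b<B. smult (l a b c) (auxterm a b c))"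
    and "a < A" "b < B" "c < C"
  shows "int p dvd l a b c"
  using assms(5-)
proof (induction c arbitrary: a b rule: less_induct)
  case (less c)
  let ?W = "\<lambda>c. logsum A B (\<lambda>a b. l a b c)"
  have split: "(\<Sum>c<C. \<Sum>a<A. \<Sum>b<B. smult (l a b c) (auxterm a b c)) = (\<Sum>c<C. X ^ (p * c) * ?W c)"
    unfolding logsum_def auxterm_def sum_distrib_left
    by (intro sum.cong refl) (simp only: mult_smult_right ac_simps)
  have "int p dvd coeff (?W c) i" if i: "i < p" for i
  proof -
    have "int p dvd coeff (\<Sum>c<C. X ^ (p * c) * ?W c) (p * c + i)"
      using dvd unfolding split const_poly_dvd_iff by blast
    also have "coeff (\<Sum>c<C. X ^ (p * c) * ?W c) (p * c + i) =
        (\<Sum>c'<C. coeff (X ^ (p * c') * ?W c') (p * c + i))" by (simp add: coeff_sum)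
    also have "\<dots> = coeff (X ^ (p * c) * ?W c) (p * c + i)
        + (\<Sum>c'\<in>{..<C} - {c}. coeff (X ^ (p * c') * ?W c') (p * c + i))"
      using less.prems by (subst sum.remove[of _ c]) auto
    also have "coeff (X ^ (p * c) * ?W c) (p * c + i) = coeff (?W c) i"
      by (simp only: coeff_X_power_mult) simp
    finally have "int p dvd coeff (?W c) i
        + (\<Sum>c'\<in>{..<C} - {c}. coeff (X ^ (p * c') * ?W c') (p * c + i))" .
    moreover have "int p dvd (\<Sum>c'\<in>{..<C} - {c}. coeff (X ^ (p * c') * ?W c') (p * c + i))"
    proof (intro dvd_sum)
      fix c' assume c': "c' \<in> {..<C} - {c}"
      show "int p dvd coeff (X ^ (p * c') * ?W c') (p * c + i)"
      proof (cases "c' < c")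
        case True
        hence "int p dvd coeff (?W c') j" for j
          using less.IH[of c'] c' unfolding logsum_def coeff_sum coeff_smult
          by (intro dvd_sum dvd_mult2) auto
        thus ?thesis unfolding coeff_X_power_mult by simp
      next
        case False
        hence "Suc c \<le> c'" using c' by auto
        hence "p * Suc c \<le> p * c'" by (rule mult_le_mono2)
        hence "p * c + i < p * c'" using i by simp
        thus ?thesis unfolding coeff_X_power_mult by simp
      qed
    qed
    ultimately show ?thesis by (simp add: dvd_add_left_iff)
  qed
  thus ?case using logsum_coeffs_dvd[OF AB, of "\<lambda>a b. l a b c" a b] less.prems by blast
qed

text \<open>The span of these terms is closed under the derivation modulo p: \<open>X^(p c)\<close>
  acts as a constant, X(1+X) \<open>g'\<close> is congruent to \<open>X - X^p\<close>, and a factor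
  X is rewritten as (1+X) - 1.\<close>

lemma wderiv_auxterm:
  "\<exists>R. wderiv (X * T) (auxterm a b c) =
     smult (int a) (auxterm (Suc a) b c) - smult (int a) (auxterm a b c)
     + smult (int b) (auxterm (Suc a) (b - 1) c - auxterm a (b - 1) c - auxterm a (b - 1) (Suc c))
     + smult (int p) R"
proof -
  let ?E = "T ^ a * g ^ b" and ?F = "T ^ a * g ^ (b - 1)" and ?Z = "X ^ (p * c)"
  have X: "T = X + 1" by (simp add: one_pCons)
  have "X * pderiv (X ^ n) = smult (int n) (X ^ n)" for n
    by (cases n) (simp_all add: pderiv_power_Suc pderiv_pCons del: power_Suc, simp)
  note Z = this[of "p * c"]
  have Xp: "X * X ^ (p - 1) = X ^ p"
    using p_gt_1 by (simp flip: power_Suc)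
  have "wderiv (X * T) (auxterm a b c) = X * (T * pderiv ?E) * ?Z + T * ?E * (X * pderiv ?Z)"
    unfolding wderiv_def auxterm_def pderiv_mult[of ?E ?Z] by (simp only: ring_distribs ac_simps)
  also have "\<dots> = smult (int a) (X * ?E * ?Z)
      + smult (int b) (?F * ?Z * (X - X ^ p)) 
      + smult (int p) (smult (int b) (X * ?F * g * ?Z) + smult (int c) (T * ?E * ?Z))"
  proof -
    have "X * (smult k E + smult m F * (1 - Y + smult (int p) g)) * Z + V * smult (int (p * c)) Z
        = smult k (X * E * Z) + smult m (F * Z * (X - X * Y))
        + smult (int p) (smult m (X * F * g * Z) + smult (int c) (V * Z))" for k m E F Y Z V
      by (simp add: algebra_simps smult_add_right smult_diff_right del: mult_pCons_left mult_pCons_right)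
    from this[of "int a" ?E "int b" ?F "X ^ (p - 1)" ?Z "T * ?E"] show ?thesis
      unfolding T_pderiv_term Z Xp .
  qed
  also have "X * ?E * ?Z = auxterm (Suc a) b c - auxterm a b c"
  proof -
    have "X * E * Z = (X + 1) * E * Z - E * Z" for E Z
      by (simp add: algebra_simps del: mult_pCons_left mult_pCons_right)
    from this[of ?E ?Z] show ?thesis
      unfolding auxterm_def power_Suc X[symmetric] by (simp only: ac_simps)
  qed
  also have "?F * ?Z * (X - X ^ p) =
      auxterm (Suc a) (b - 1) c - auxterm a (b - 1) c - auxterm a (b - 1) (Suc c)"
  proof -
    have "F * Z * (X - Y) = (X + 1) * F * Z - F * Z - F * (Y * Z)" for F Z Y
      by (simp add: algebra_simps del: mult_pCons_left mult_pCons_right)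
    from this[of ?F ?Z "X ^ p"] show ?thesis
      unfolding auxterm_def power_Suc X[symmetric] by (simp only: power_add mult_Suc_right ac_simps)
  qed
  finally show ?thesis unfolding smult_diff_right by blast
qed

text \<open>Every application of $X(1+X) d/dX$ raises the degree of the representing polynomial
  by one only, although the degree of the differentiated polynomial is of size $p$.\<close>

lemma poly_wderiv_auxterm_low_degree:
  "\<exists>E. degree E \<le> a + b + c + n \<and>
     (\<forall>x. int p dvd poly g x - (\<alpha> * x + \<beta>) \<longrightarrow> int p dvd x ^ p - x \<longrightarrow>
        [poly ((wderiv (X * T) ^^ n) (auxterm a b c)) x = poly E x] (mod int p))"
proof (induction n arbitrary: a b c)
  case 0
  \<comment> \<open>Obtained by substituting \<alpha> X + \<beta> for \<open>g\<close> and X for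
    \<open>X^p\<close>.\<close>
  let ?E = "T ^ a * [:\<beta>, \<alpha>:] ^ b * X ^ c"
  have "degree ([:\<beta>, \<alpha>:] ^ b) \<le> 1 * b"
    by (intro order_trans[OF degree_power_le] mult_le_mono1) simp
  hence "degree (T ^ a) + degree ([:\<beta>, \<alpha>:] ^ b) + degree (X ^ c) \<le> a + b + c"
    by (simp add: degree_linear_power)
  hence "degree ?E \<le> a + b + c"
    by (meson add_mono degree_mult_le le_refl order_trans)
  moreover have "[poly (auxterm a b c) x = poly ?E x] (mod int p)"
    if "int p dvd poly g x - (\<alpha> * x + \<beta>)" "int p dvd x ^ p - x" for x
  proof -
    have "[poly g x = \<beta> + x * \<alpha>] (mod int p)" "[x ^ p = x] (mod int p)"
      using that by (simp_all add: cong_iff_dvd_diff algebra_simps)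
    hence "[(1 + x) ^ a * poly g x ^ b * (x ^ p) ^ c = (1 + x) ^ a * (\<beta> + x * \<alpha>) ^ b * x ^ c] (mod int p)"
      by (intro cong_mult cong_pow cong_refl)
    thus ?thesis by (simp add: auxterm_def poly_power power_mult)
  qed
  ultimately show ?case by (intro exI[of _ ?E]) simp
next
  case (Suc n)
  let ?D = "wderiv (X * T) ^^ n"
  let ?ok = "\<lambda>x. int p dvd poly g x - (\<alpha> * x + \<beta>) \<and> int p dvd x ^ p - x"
  from Suc.IH have "\<exists>E. \<forall>a b c. degree (E a b c) \<le> a + b + c + n \<and>
     (\<forall>x. ?ok x \<longrightarrow> [poly (?D (auxterm a b c)) x = poly (E a b c) x] (mod int p))"
    by metis
  then obtain E where deg: "\<And>a b c. degree (E a b c) \<le> a + b + c + n"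
    and E: "\<And>a b c x. ?ok x \<Longrightarrow> [poly (?D (auxterm a b c)) x = poly (E a b c) x] (mod int p)"
    by blast
  obtain R where R: "wderiv (X * T) (auxterm a b c) =
     smult (int a) (auxterm (Suc a) b c) - smult (int a) (auxterm a b c)
     + smult (int b) (auxterm (Suc a) (b - 1) c - auxterm a (b - 1) c - auxterm a (b - 1) (Suc c))
     + smult (int p) R" using wderiv_auxterm by blast
  let ?E = "smult (int a) (E (Suc a) b c) - smult (int a) (E a b c)
     + smult (int b) (E (Suc a) (b - 1) c - E a (b - 1) c - E a (b - 1) (Suc c))"
  have "degree ?E \<le> a + b + c + Suc n"
  proof (intro degree_add_le degree_diff_le)
    show "degree (smult (int b) (E (Suc a) (b - 1) c - E a (b - 1) c - E a (b - 1) (Suc c)))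
        \<le> a + b + c + Suc n"
      by (intro order_trans[OF degree_smult_le] degree_diff_le order_trans[OF deg]) auto
  qed (intro order_trans[OF degree_smult_le] order_trans[OF deg]; simp)+
  moreover have "[poly ((wderiv (X * T) ^^ Suc n) (auxterm a b c)) x = poly ?E x] (mod int p)"
    if x: "?ok x" for x
  proof -
    let ?v = "\<lambda>a b c. poly (?D (auxterm a b c)) x"
    have "poly ((wderiv (X * T) ^^ Suc n) (auxterm a b c)) x =
        poly (?D (wderiv (X * T) (auxterm a b c))) x"
      by (simp only: funpow_Suc_right o_apply)
    also have "\<dots> = int a * ?v (Suc a) b c - int a * ?v a b c
       + int b * (?v (Suc a) (b - 1) c - ?v a (b - 1) c - ?v a (b - 1) (Suc c)) + int p * poly (?D R) x"
      unfolding R wderiv_funpow_add wderiv_funpow_diff wderiv_funpow_smult poly_add poly_diff poly_smult ..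
    also have "[\<dots> = poly ?E x + 0] (mod int p)"
      unfolding poly_add poly_diff poly_smult
      by (intro cong_add cong_diff cong_scalar_left E x) (simp add: cong_0_iff)
    finally show ?thesis by simp
  qed
  ultimately show ?case by blast
qed

section \<open>Stepanov's bound for the solutions of g(x) = \<alpha> x + \<beta>\<close>

text \<open>There are \<open>A B C\<close> unknown coefficients. Vanishing of the D derivatives at
  all of \<open>S\<close> follows if D polynomials of degree below A + B + C + D are 0 modulo p,
  which is the count in \<open>dim\<close>. The values 0 and -1 are left out of \<open>S\<close>
  because X(1+X) vanishes there.\<close>

theorem card_linear_solutions:
  fixes S :: "int set"
  assumes AB: "A \<le> p" "B \<le> p" "A * B \<le> p" and D: "D \<le> p"
    and dim: "D * (A + B + C + D) < A * B * C"
    and S: "S \<subseteq> {1..int p - 2}"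
    and sol: "\<And>x. x \<in> S \<Longrightarrow> int p dvd poly g x - (\<alpha> * x + \<beta>)"
    and fermat: "\<And>x. x \<in> S \<Longrightarrow> int p dvd x ^ p - x"
  shows "card S * D \<le> A + p * B + p * C"
proof -
  let ?w = "X * T"
  from poly_wderiv_auxterm_low_degree[of _ _ _ _ \<alpha> \<beta>] 
  have "\<forall>n a b c. \<exists>E. degree E \<le> a + b + c + n \<and> (\<forall>x\<in>S.
        [poly ((wderiv ?w ^^ n) (auxterm a b c)) x = poly E x] (mod int p))"
    using sol fermat by meson
  then obtain E where deg: "\<And>n a b c. degree (E n a b c) \<le> a + b + c + n"
    and E: "\<And>n a b c x. x \<in> S \<Longrightarrow>
        [poly ((wderiv ?w ^^ n) (auxterm a b c)) x = poly (E n a b c) x] (mod int p)"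
    by metis
  let ?I = "{..<C} \<times> {..<A} \<times> {..<B}" and ?J = "{..<D} \<times> {..<A + B + C + D}"
  let ?e = "\<lambda>(n, k) (c, a, b). coeff (E n a b c) k"
  have "card ?J < card ?I" using dim by (simp add: card_cartesian_product mult_ac)
  then obtain l where l: "\<exists>i\<in>?I. \<not> int p dvd l i"
    and sys: "\<forall>j\<in>?J. int p dvd (\<Sum>i\<in>?I. l i * ?e j i)"
    using homogeneous_system_mod[OF p_gt_1, of ?I ?J ?e] by auto
  define P where "P = (\<Sum>i\<in>?I. case i of (c, a, b) \<Rightarrow> smult (l i) (auxterm a b c))"
  have nz: "\<not> [:int p:] dvd P"
  proof
    assume "[:int p:] dvd P"
    also have "P = (\<Sum>c<C. \<Sum>a<A. \<Sum>b<B. smult (l (c, a, b)) (auxterm a b c))"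
      unfolding P_def by (simp add: sum.cartesian_product case_prod_beta)
    finally have "\<forall>a<A. \<forall>b<B. \<forall>c<C. int p dvd l (c, a, b)"
      using auxsum_coeffs_dvd[OF AB, where C = C and l = "\<lambda>a b c. l (c, a, b)"] by blast
    thus False using l by auto
  qed
  have van: "int p dvd poly ((wderiv ?w ^^ n) P) x" if x: "x \<in> S" and n: "n < D" for x n
  proof -
    let ?Q = "\<Sum>i\<in>?I. case i of (c, a, b) \<Rightarrow> smult (l i) (E n a b c)"
    have "poly ((wderiv ?w ^^ n) P) x =
        (\<Sum>i\<in>?I. case i of (c, a, b) \<Rightarrow> l i * poly ((wderiv ?w ^^ n) (auxterm a b c)) x)"
      unfolding P_def wderiv_funpow_sum poly_sum
      by (intro sum.cong refl) (simp only: case_prod_beta wderiv_funpow_smult poly_smult)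
    also have "[\<dots> = (\<Sum>i\<in>?I. case i of (c, a, b) \<Rightarrow> l i * poly (E n a b c) x)] (mod int p)"
      unfolding case_prod_beta by (intro cong_sum cong_scalar_left E x)
    also have "(\<Sum>i\<in>?I. case i of (c, a, b) \<Rightarrow> l i * poly (E n a b c) x) = poly ?Q x"
      unfolding poly_sum by (intro sum.cong refl) (simp add: case_prod_beta)
    finally have cong: "[poly ((wderiv ?w ^^ n) P) x = poly ?Q x] (mod int p)" .
    have "int p dvd coeff ?Q k" for k
    proof (cases "k < A + B + C + D")
      case True
      have "coeff ?Q k = (\<Sum>i\<in>?I. l i * ?e (n, k) i)"
        unfolding coeff_sum by (intro sum.cong refl) (simp add: case_prod_beta)
      thus ?thesis using sys n True by auto
    next
      case False
      have "coeff (E n a b c) k = 0" if "a < A" "b < B" "c < C" for a b c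
        using that False n deg[of n a b c] by (intro coeff_eq_0) linarith
      hence "coeff ?Q k = 0" unfolding coeff_sum by (intro sum.neutral) auto
      thus ?thesis by simp
    qed
    hence "[:int p:] dvd ?Q" by (simp add: const_poly_dvd_iff)
    hence "int p dvd poly ?Q x" by (auto elim!: dvdE)
    thus ?thesis using cong cong_dvd_iff by blast
  qed
  have "card S * D \<le> degree P"
  proof (rule card_zeros_mult_order_le_degree[OF prime D _ _ _ van nz])
    show "finite S" using S finite_subset by blast
    show "x = y" if "x \<in> S" "y \<in> S" "int p dvd x - y" for x y
    proof -
      have "x mod int p = y mod int p" using that by (simp add: mod_eq_dvd_iff)
      moreover have "x \<in> {1..int p - 2}" "y \<in> {1..int p - 2}" using that S by auto
      ultimately show ?thesis by simp
    qed
    show "\<not> int p dvd poly ?w x" if "x \<in> S" for x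
    proof -
      have x: "1 \<le> x" "x \<le> int p - 2" using S that by auto
      hence "\<not> int p dvd x" "\<not> int p dvd 1 + x" by (auto dest!: zdvd_imp_le)
      moreover have "poly ?w x = x * (1 + x)" by (simp add: algebra_simps)
      ultimately show ?thesis using prime_int by (simp only: prime_dvd_mult_iff) simp
    qed
  qed
  also have "degree P \<le> A + p * B + p * C"
    unfolding P_def
  proof (intro degree_sum_le)
    fix i assume "i \<in> ?I"
    then obtain a b c where i: "i = (c, a, b)" "a < A" "b < B" "c < C" by auto
    have "degree (smult (l i) (auxterm a b c)) \<le> a + p * b + p * c"
      using degree_auxterm degree_smult_le order_trans by blast
    also have "\<dots> \<le> A + p * B + p * C"
      using i by (intro add_mono mult_le_mono2) auto
    finally show "degree (case i of (c, a, b) \<Rightarrow> smult (l i) (auxterm a b c)) \<le> A + p * B + p * C"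
      using i by simp
  qed simp
  finally show ?thesis .
qed

end

section \<open>Fixed points of Fermat quotients\<close>

text \<open>The inner binomial coefficients are divisible by p, and the two outer terms
  cancel.\<close>

lemma ex_mirimanoff:
  assumes "prime p"
  shows "\<exists>g. mirimanoff p g"
proof -
  have "int p dvd coeff (T ^ p - X ^ p - 1) i" for i
  proof -
    have X: "X ^ p = monom 1 p" by (simp add: monom_altdef)
    consider "i = 0" | "0 < i" "i < p" | "i = p" | "i > p" by linarith
    thus ?thesis
    proof cases
      case 2
      hence "int p dvd int (p choose i)"
        using dvd_choose_prime[of i p] assms by auto
      thus ?thesis unfolding X using 2 by (simp add: coeff_linear_poly_power coeff_1)
    next
      case 4
      hence "coeff (T ^ p) i = 0" by (intro coeff_eq_0) (simp add: degree_linear_power)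
      thus ?thesis unfolding X using 4 by (simp add: coeff_1)
    qed (use assms prime_gt_0_nat in \<open>auto simp: X coeff_linear_poly_power coeff_1\<close>)
  qed
  hence "[:int p:] dvd T ^ p - X ^ p - 1" unfolding const_poly_dvd_iff by blast
  then obtain g where "T ^ p - X ^ p - 1 = [:int p:] * g" by (elim dvdE)
  thus ?thesis using assms by (auto simp: mirimanoff_def)
qed

section \<open>Congruences modulo the square of p\<close>

text \<open>In \<open>a^p - b^p = (a - b) * sum\<close> the sum is congruent to
  \<open>p b^(p-1)\<close>, so it supplies the second factor p.\<close>

lemma power_prime_cong_square:
  fixes a b :: int
  assumes "int p dvd a - b"
  shows "int p ^ 2 dvd a ^ p - b ^ p"
proof -
  have "[a = b] (mod int p)" using assms by (simp add: cong_iff_dvd_diff)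
  hence "[(\<Sum>i<p. b ^ (p - Suc i) * a ^ i) = (\<Sum>i<p. b ^ (p - Suc i) * b ^ i)] (mod int p)"
    by (intro cong_sum cong_mult cong_pow cong_refl)
  also have "(\<Sum>i<p. b ^ (p - Suc i) * b ^ i) = (\<Sum>i<p. b ^ (p - 1))"
    by (intro sum.cong refl) (simp flip: power_add)
  also have "\<dots> = int p * b ^ (p - 1)" by simp
  finally have "int p dvd (\<Sum>i<p. b ^ (p - Suc i) * a ^ i)"
    by (simp add: cong_dvd_iff)
  thus ?thesis unfolding power_diff_sumr2 power2_eq_square using assms by (rule mult_dvd_mono[rotated])
qed

lemma fermat_int:
  assumes "prime p"
  shows "int p dvd int x ^ p - int x"
proof (cases "p dvd x")
  case True
  thus ?thesis using assms prime_gt_0_nat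
    by (intro dvd_diff dvd_power_le[of _ _ 1 p, simplified]) (auto simp: Suc_leI)
next
  case False
  have "[int x ^ (p - 1) = 1] (mod int p)"
    using fermat_theorem[OF assms False] by (metis cong_int_iff of_nat_1 of_nat_power)
  hence "int p dvd int x * (int x ^ (p - 1) - 1)" by (simp add: cong_iff_dvd_diff)
  moreover have "int x ^ p = int x * int x ^ (p - 1)"
    using assms prime_gt_0_nat by (simp flip: power_Suc)
  ultimately show ?thesis by (simp add: right_diff_distrib)
qed

text \<open>Write \<open>u^(p-1) = 1 + p k\<close>; a non-zero fixed point has k congruent to u
  modulo p, and multiplication by u gives the claim. This form suits the expansion of
  \<open>(v + d)^p\<close>.\<close>

lemma fixed_point_cong_square:
  assumes p: "prime p" and "u < p" and fp: "fermat_quotient p (int u) = int u"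
  shows "int p ^ 2 dvd int u ^ p - int u - int p * int u ^ 2"
proof (cases "u = 0")
  case True
  thus ?thesis using prime_gt_0_nat[OF p] by (simp add: power_0_left)
next
  case False
  hence ndvd: "\<not> p dvd u" using \<open>u < p\<close> by (auto dest!: dvd_imp_le)
  have "[int u ^ (p - 1) = 1] (mod int p)"
    using fermat_theorem[OF p ndvd] by (metis cong_int_iff of_nat_1 of_nat_power)
  then obtain k where k: "int u ^ (p - 1) - 1 = int p * k"
    by (auto simp: cong_iff_dvd_diff)
  have "k mod int p = int u"
    using fp ndvd k p prime_gt_0_nat by (simp add: fermat_quotient_def)
  hence "k mod int p = int u mod int p" using \<open>u < p\<close> by simp
  hence "int p dvd k - int u" by (simp add: mod_eq_dvd_iff)
  hence "int p * int p dvd int p * (int u * (k - int u))" by simp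
  moreover have "int u ^ p = int u * int u ^ (p - 1)"
    using p prime_gt_0_nat by (simp flip: power_Suc)
  hence "int u ^ p - int u - int p * int u ^ 2 = int p * (int u * (k - int u))"
    using k by (simp add: algebra_simps power2_eq_square)
  ultimately show ?thesis by (simp add: power2_eq_square)
qed

text \<open>Since d x and d (1 + x) are congruent to v and v + d modulo p, their p-th powers agree
  modulo \<open>p^2\<close>. Thus \<open>d^p p g(x)\<close> is congruent to
  \<open>(v+d)^p - v^p - d^p\<close>, which the fixed point congruences turn into
  \<open>p d (2 v + d) - p s\<close>. Here \<open>e\<close> is the inverse of d.\<close>

lemma (in mirimanoff) fixed_point_pair_solution:
  assumes e: "int p dvd int d * e - 1" and s: "int d ^ p - int d = int p * s"
    and v: "int p ^ 2 dvd int v ^ p - int v - int p * int v ^ 2"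
    and u: "int p ^ 2 dvd int (v + d) ^ p - int (v + d) - int p * int (v + d) ^ 2"
    and x: "int p dvd int d * x - int v"
  shows "int p dvd poly g x - (2 * int d * x + (int d - e * s))"
proof -
  let ?d = "int d" and ?v = "int v" and ?p = "int p"
  have "?p ^ 2 dvd (?d * x) ^ p - ?v ^ p" using x by (rule power_prime_cong_square)
  moreover have "?p ^ 2 dvd (?d * (1 + x)) ^ p - int (v + d) ^ p"
    using x by (intro power_prime_cong_square) (simp add: algebra_simps)
  ultimately have "?p ^ 2 dvd ((?d * (1 + x)) ^ p - int (v + d) ^ p)
       - ((?d * x) ^ p - ?v ^ p)
       + (int (v + d) ^ p - int (v + d) - ?p * int (v + d) ^ 2) - (?v ^ p - ?v - ?p * ?v ^ 2)"
    using u v by (blast intro: dvd_add dvd_diff)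
  also have "\<dots> = (?d * (1 + x)) ^ p - (?d * x) ^ p - ?d ^ p + (?d ^ p - ?d) - ?p * (int (v + d) ^ 2 - ?v ^ 2)"
    by (simp add: right_diff_distrib)
  also have "\<dots> = ?d ^ p * ((1 + x) ^ p - x ^ p - 1) + (?d ^ p - ?d) - ?p * (int (v + d) ^ 2 - ?v ^ 2)"
    unfolding power_mult_distrib right_diff_distrib by simp
  also have "\<dots> = ?p * (?d ^ p * poly g x + s - ?d * (2 * ?v + ?d))"
    unfolding poly_g[symmetric] s by (simp add: algebra_simps power2_eq_square)
  finally have "?p dvd ?d ^ p * poly g x + s - ?d * (2 * ?v + ?d)"
    using p_gt_1 by (simp add: power2_eq_square)
  \<comment> \<open>After division by p it suffices to work modulo p: \<open>d^p\<close> becomes d,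
    v becomes d x, and multiplication by \<open>e\<close> cancels d.\<close>
  moreover have "?p dvd (?d ^ p - ?d) * poly g x" using s by simp
  moreover have "?p dvd 2 * ?d * (?d * x - ?v)" using x by simp
  ultimately have "?p dvd (?d ^ p * poly g x + s - ?d * (2 * ?v + ?d)) - (?d ^ p - ?d) * poly g x
      - 2 * ?d * (?d * x - ?v)"
    by (blast intro: dvd_diff)
  also have "\<dots> = ?d * (poly g x - (2 * ?d * x + ?d)) + s"
    by (simp add: algebra_simps)
  finally have "?p dvd e * (?d * (poly g x - (2 * ?d * x + ?d)) + s)"
    by (rule dvd_mult)
  moreover have "?p dvd (?d * e - 1) * (poly g x - (2 * ?d * x + ?d))"
    using e by simp
  ultimately have "?p dvd e * (?d * (poly g x - (2 * ?d * x + ?d)) + s)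
      - (?d * e - 1) * (poly g x - (2 * ?d * x + ?d))"
    by (rule dvd_diff)
  also have "\<dots> = poly g x - (2 * ?d * x + (?d - e * s))"
    by (simp add: algebra_simps)
  finally show ?thesis .
qed

definition fixed_points :: "nat \<Rightarrow> nat set" where
  "fixed_points p = {u \<in> {0..<p}. fermat_quotient p (int u) = int u}"

text \<open>With m of order \<open>p^(1/3)\<close> this is the bound \<open>O(p^(2/3))\<close> for
  each difference d.\<close>

lemma card_fixed_point_pairs:
  assumes p: "prime p" and d: "0 < d" "d < p" and m: "0 < m" "4 * m ^ 3 \<le> p"
  shows "card {v \<in> fixed_points p. v + d \<in> fixed_points p} * m \<le> 4 * m + 4 * p"
proof -
  obtain g where "mirimanoff p g" using ex_mirimanoff[OF p] by blast
  then interpret mirimanoff p g .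
  let ?V = "{v \<in> fixed_points p. v + d \<in> fixed_points p}"
  have "coprime (int d) (int p)"
    using p d by (metis coprime_commute coprime_int_iff dvd_imp_le leD prime_imp_coprime)
  then obtain e where "[int d * e = 1] (mod int p)" using cong_solve_coprime_int by blast
  hence e: "int p dvd int d * e - 1" by (simp add: cong_iff_dvd_diff)
  obtain s where s: "int d ^ p - int d = int p * s" using fermat_int[OF p, of d] by (elim dvdE)
  \<comment> \<open>The residue of v/d, with \<open>e\<close> as the inverse of d.\<close>
  define x where "x = (\<lambda>v. (int v * e) mod int p)"
  have x: "int p dvd int d * x v - int v" for v
  proof -
    have "[int d * x v = int d * (int v * e)] (mod int p)"
      unfolding x_def by (intro cong_scalar_left) simp
    also have "[int d * (int v * e) = int v] (mod int p)"
      using dvd_mult[OF e, of "int v"] by (simp add: cong_iff_dvd_diff algebra_simps)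
    finally show ?thesis by (simp add: cong_iff_dvd_diff)
  qed
  have range: "0 \<le> x v" "x v < int p" for v using p_gt_1 by (simp_all add: x_def)
  have inj: "inj_on x ?V"
  proof (rule inj_onI)
    fix v v' assume v: "v \<in> ?V" "v' \<in> ?V" and eq: "x v = x v'"
    have "int p dvd (int d * x v' - int v') - (int d * x v - int v)" by (intro dvd_diff x)
    hence "int v mod int p = int v' mod int p" by (simp add: eq mod_eq_dvd_iff)
    thus "v = v'" using v by (simp add: fixed_points_def)
  qed
  \<comment> \<open>Removing the zeros 0 and -1 of the weight X(1+X) costs at most two
    elements.\<close>
  define S where "S = x ` ?V - {0, int p - 1}"
  have fin: "finite ?V" by (simp add: fixed_points_def)
  \<comment> \<open>The choice is \<open>A = 2 m^2\<close>, \<open>B = C = 2 m\<close>,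
    \<open>D = m^2\<close>: then \<open>A B = 4 m^3\<close> is at most p, and the dimension
    condition reads \<open>3 m^4 + 4 m^3 < 8 m^4\<close>.\<close>
  have "card S * m ^ 2 \<le> 2 * m ^ 2 + p * (2 * m) + p * (2 * m)"
  proof (rule card_linear_solutions)
    have "m ^ 2 \<le> m ^ 3" "m \<le> m ^ 3" using m by (simp_all add: power_increasing self_le_power)
    thus "2 * m ^ 2 \<le> p" "2 * m \<le> p" "m ^ 2 \<le> p" using m by linarith+
    show "2 * m ^ 2 * (2 * m) \<le> p" using m by (simp add: power3_eq_cube power2_eq_square)
    have "m ^ 3 * 1 \<le> m ^ 3 * m" using m by (intro mult_le_mono2) simp
    moreover have "0 < m ^ 3 * m" using m by simp
    ultimately have "3 * (m ^ 3 * m) + 4 * m ^ 3 < 8 * (m ^ 3 * m)" by linarith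
    thus "m\<^sup>2 * (2 * m\<^sup>2 + 2 * m + 2 * m + m\<^sup>2) < 2 * m\<^sup>2 * (2 * m) * (2 * m)"
      by (simp add: power3_eq_cube power2_eq_square algebra_simps)
    show "S \<subseteq> {1..int p - 2}"
    proof
      fix y assume "y \<in> S"
      then obtain v where "y = x v" "y \<noteq> 0" "y \<noteq> int p - 1" by (auto simp: S_def)
      thus "y \<in> {1..int p - 2}" using range[of v] by auto
    qed
    fix y assume "y \<in> S"
    then obtain v where y: "y = x v" and v: "v \<in> ?V" by (auto simp: S_def)
    show "int p dvd poly g y - (2 * int d * y + (int d - e * s))"
      unfolding y using v by (intro fixed_point_pair_solution[OF e s _ _ x] fixed_point_cong_square p)
        (auto simp: fixed_points_def)
    show "int p dvd y ^ p - y"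
      using fermat_int[OF p, of "nat y"] range[of v] y by simp
  qed
  hence "m * (card S * m) \<le> m * (2 * m + 4 * p)"
    by (simp add: power2_eq_square algebra_simps)
  hence "card S * m \<le> 2 * m + 4 * p" using m by simp
  moreover have "card ?V \<le> card S + 2"
  proof -
    have "card ?V = card (x ` ?V)" using inj by (simp add: card_image)
    also have "\<dots> \<le> card (S \<union> {0, int p - 1})"
      using fin by (intro card_mono) (auto simp: S_def)
    also have "\<dots> \<le> card S + card {0, int p - 1}" by (rule card_Un_le)
    also have "\<dots> \<le> card S + 2" by (simp add: card_insert_if)
    finally show ?thesis .
  qed
  hence "card ?V * m \<le> (card S + 2) * m" by (rule mult_le_mono1)
  ultimately show ?thesis by simp
qed

section \<open>From pairs with given difference to the bound for \<open>F\<close>\<close>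

text \<open>Every ordered pair has the form (v, v + d) or (v + d, v) with 0 \<le> d < n.\<close>

lemma card_squared_le_sum_differences:
  fixes U :: "nat set"
  assumes "U \<subseteq> {0..<n}"
  shows "card U ^ 2 \<le> 2 * (\<Sum>d<n. card {v \<in> U. v + d \<in> U})"
proof -
  let ?V = "\<lambda>d. {v \<in> U. v + d \<in> U}"
  let ?P = "\<Union>d<n. (\<lambda>v. (v, v + d)) ` ?V d" and ?Q = "\<Union>d<n. (\<lambda>v. (v + d, v)) ` ?V d"
  have fin: "finite U" using assms finite_subset by blast
  have "U \<times> U \<subseteq> ?P \<union> ?Q"
  proof
    fix z assume z: "z \<in> U \<times> U"
    then obtain u v where uv: "z = (u, v)" "u \<in> U" "v \<in> U" by auto
    hence "u < n" "v < n" using assms by auto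
    show "z \<in> ?P \<union> ?Q"
    proof (cases "u \<le> v")
      case True
      hence "z \<in> (\<lambda>w. (w, w + (v - u))) ` ?V (v - u)" using uv by (intro image_eqI[of _ _ u]) auto
      moreover have "v - u < n" using \<open>v < n\<close> by simp
      ultimately show ?thesis by blast
    next
      case False
      hence "z \<in> (\<lambda>w. (w + (u - v), w)) ` ?V (u - v)" using uv by (intro image_eqI[of _ _ v]) auto
      moreover have "u - v < n" using \<open>u < n\<close> by simp
      ultimately show ?thesis by blast
    qed
  qed
  hence "card (U \<times> U) \<le> card (?P \<union> ?Q)" using fin by (intro card_mono) auto
  also have "\<dots> \<le> card ?P + card ?Q" by (rule card_Un_le)
  also have "card ?P \<le> (\<Sum>d<n. card ((\<lambda>v. (v, v + d)) ` ?V d))" by (rule card_UN_le) simp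
  also have "\<dots> \<le> (\<Sum>d<n. card (?V d))" using fin by (intro sum_mono card_image_le) auto
  also have "card ?Q \<le> (\<Sum>d<n. card ((\<lambda>v. (v + d, v)) ` ?V d))" by (rule card_UN_le) simp
  also have "\<dots> \<le> (\<Sum>d<n. card (?V d))" using fin by (intro sum_mono card_image_le) auto
  finally show ?thesis by (simp add: card_cartesian_product power2_eq_square)
qed

lemma F_le: "F p \<le> p"
proof -
  have "F p \<le> card {0..<p}" unfolding F_def by (intro card_mono) auto
  thus ?thesis by simp
qed

text \<open>After multiplication by m, the difference 0 contributes at most \<open>p^2\<close> and
  each other difference at most 4 m + 4 p \<le> 8 p; hence the constant 2 (1 + 8) = 18.\<close>

lemma F_squared_bound:
  assumes p: "prime p" and m: "0 < m" "4 * m ^ 3 \<le> p"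
  shows "F p ^ 2 * m \<le> 18 * p ^ 2"
proof -
  let ?V = "\<lambda>d. {v \<in> fixed_points p. v + d \<in> fixed_points p}"
  have F: "F p = card (fixed_points p)" by (simp add: F_def fixed_points_def)
  have "m \<le> m ^ 3" using m by (simp add: self_le_power)
  hence mp: "m \<le> p" using m by linarith
  have "(\<Sum>d<p. card (?V d)) = card (?V 0) + (\<Sum>d\<in>{..<p} - {0}. card (?V d))"
    using p prime_gt_0_nat by (subst sum.remove[of _ 0]) auto
  hence "(\<Sum>d<p. card (?V d)) * m = F p * m + (\<Sum>d\<in>{..<p} - {0}. card (?V d) * m)"
    by (simp add: F add_mult_distrib sum_distrib_right)
  also have "\<dots> \<le> p * p + (\<Sum>d\<in>{..<p} - {0}. 4 * m + 4 * p)"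
    by (intro add_mono mult_le_mono F_le mp sum_mono card_fixed_point_pairs p m) auto
  also have "\<dots> \<le> p * p + (\<Sum>d<p. 4 * m + 4 * p)"
    by (intro add_left_mono sum_mono2) auto
  also have "\<dots> = p * p + p * (4 * m + 4 * p)" by simp
  also have "\<dots> \<le> p * p + p * (4 * p + 4 * p)" using mp by (intro add_left_mono mult_le_mono2) simp
  finally have "2 * (\<Sum>d<p. card (?V d)) * m \<le> 18 * p ^ 2"
    by (simp add: power2_eq_square mult.commute)
  moreover have "F p ^ 2 * m \<le> 2 * (\<Sum>d<p. card (?V d)) * m"
    unfolding F by (intro mult_le_mono1 card_squared_le_sum_differences) (auto simp: fixed_points_def)
  ultimately show ?thesis by linarith
qed

text \<open>The bound \<open>F p = O(p^(5/6))\<close> without roots, from the largest m with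
  \<open>4 m^3\<close> at most p.\<close>

theorem F_power6_bound:
  assumes p: "prime p"
  shows "F p ^ 6 \<le> 8 ^ 6 * p ^ 5"
\<comment> \<open>For p < 4 no positive m is admissible, and the trivial bound suffices.\<close>
proof (cases "p < 4")
  case True
  have "F p ^ 6 \<le> p ^ 6" by (intro power_mono F_le) simp
  also have "p ^ 6 = p * p ^ 5" by (simp add: eval_nat_numeral)
  also have "\<dots> \<le> 8 ^ 6 * p ^ 5" using True by (intro mult_le_mono1) simp
  finally show ?thesis .
next
  case False
  define m where "m = (GREATEST m. 4 * m ^ 3 \<le> p)"
  have bound: "\<forall>k. 4 * k ^ 3 \<le> p \<longrightarrow> k \<le> p"
  proof (intro allI impI)
    fix k assume "4 * k ^ 3 \<le> p"
    moreover have "k \<le> k ^ 3" by (cases "k = 0") (simp_all add: self_le_power)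
    ultimately show "k \<le> p" by linarith
  qed
  have one: "4 * 1 ^ 3 \<le> p" using False by simp
  have m: "4 * m ^ 3 \<le> p" unfolding m_def
    by (rule GreatestI_nat[of "\<lambda>m. 4 * m ^ 3 \<le> p", OF one]) (use bound in blast)
  have max: "k \<le> m" if "4 * k ^ 3 \<le> p" for k unfolding m_def
    by (rule Greatest_le_nat[of "\<lambda>m. 4 * m ^ 3 \<le> p", OF that]) (use bound in blast)
  have "m \<ge> 1" using one by (rule max)
  have "\<not> 4 * Suc m ^ 3 \<le> p" using max[of "Suc m"] by linarith
  moreover have "Suc m ^ 3 \<le> (2 * m) ^ 3" using \<open>m \<ge> 1\<close> by (intro power_mono) auto
  \<comment> \<open>Maximality gives \<open>p < 4 (m+1)^3\<close>, and m + 1 \<le> 2 m yields the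
    factor 4 * 8 = 32. Then \<open>32 * 18^3 = 186624\<close> lies below
    \<open>8^6 = 262144\<close>.\<close>
  ultimately have pm: "p \<le> 32 * m ^ 3" by (simp add: power_mult_distrib)
  have "F p ^ 6 * p \<le> F p ^ 6 * (32 * m ^ 3)" using pm by (rule mult_le_mono2)
  also have "\<dots> = 32 * (F p ^ 2 * m) ^ 3" by (simp add: power_mult_distrib flip: power_mult)
  also have "\<dots> \<le> 32 * (18 * p ^ 2) ^ 3"
    using F_squared_bound[OF p _ m] \<open>m \<ge> 1\<close> by (intro mult_le_mono2 power_mono) auto
  also have "\<dots> = 186624 * p ^ 6" by (simp add: power_mult_distrib flip: power_mult)
  also have "p ^ 6 = p ^ 5 * p" by (simp add: eval_nat_numeral)
  also have "186624 * (p ^ 5 * p) \<le> (8 ^ 6 * p ^ 5) * p" by simp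
  finally show ?thesis using p prime_gt_0_nat by simp
qed

theorem theorem8:
  shows "\<forall>\<epsilon>::real>0. \<exists>P. \<forall>p::nat. prime p \<and> p \<ge> P \<longrightarrow>
           real (F p) \<le> real p powr (11/12 + \<epsilon>)"
\<comment> \<open>The gap between the exponents 5/6 and 11/12 absorbs the constant 8: in twelfth
  powers, \<open>8^12 p^10\<close> is at most \<open>p^11\<close> once p \<ge>
  \<open>8^12\<close>.\<close>
proof (intro allI impI exI[of _ "8 ^ 12"], elim conjE)
  fix \<epsilon> :: real and p :: nat
  assume \<epsilon>: "\<epsilon> > 0" and p: "prime p" and large: "8 ^ 12 \<le> p"
  have p0: "real p \<ge> 1" using p prime_gt_0_nat[of p] by simp
  have "F p ^ 12 = (F p ^ 6) ^ 2" by (simp flip: power_mult)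
  also have "\<dots> \<le> (8 ^ 6 * p ^ 5) ^ 2" by (intro power_mono F_power6_bound p) simp
  also have "\<dots> = 8 ^ 12 * p ^ 10" by (simp add: power_mult_distrib flip: power_mult)
  also have "\<dots> \<le> p * p ^ 10" using large by (rule mult_le_mono1)
  also have "\<dots> = p ^ 11" by (simp add: eval_nat_numeral)
  finally have "real (F p) ^ 12 \<le> real p ^ 11" by (metis of_nat_le_iff of_nat_power)
  also have "\<dots> = (real p powr (11 / 12)) ^ 12"
    using p0 by (simp add: powr_power)
  finally have "real (F p) \<le> real p powr (11 / 12)"
    by (subst (asm) power_mono_iff) auto
  also have "\<dots> \<le> real p powr (11 / 12 + \<epsilon>)" using p0 \<epsilon> by (intro powr_mono) auto
  finally show "real (F p) \<le> real p powr (11 / 12 + \<epsilon>)" .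
qed

end
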